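(* Let $A$ be a real $m\times n$ matrix with pattern $P$ and suppose $A$ has the SSVP. Then for every $M\in\mathbb{R}^{m\times n}$ sufficiently close to $A$ (i.e. there is $\varepsilon>0$ such that for every $M$ with $\|M-A\|<\varepsilon$), there exists a real $m\times n$ matrix that has the SSVP, has pattern $P$, and has list of singular values $\Sigma(M)$.
   Context: All matrices are real. A pattern is a matrix with entries in $\{0,1\}$. The pattern of a matrix $A$ is the $(0,1)$-matrix obtained from $A$ by replacing each nonzero entry by $1$. $\Sigma(M)$ denotes the list (with multiplicity) of singular values of the $m\times n$ matrix $M$; for $m\le n$ these are the $m$ nonnegative square roots of the eigenvalues of $MM^\top$, and for $m>n$ the same formula may be used. $A\circ X$ is the entrywise (Schur) product, and $\|\cdot\|$ is the Euclidean (Frobenius) norm. An $m\times n$ matrix $A$ has the Strong Singular Value Property (SSVP) if the zero matrix is the only real $m\times n$ matrix $X$ such that $XA^\top$ is symmetric, $A^\top X$ is symmetric, and $A\circ X=O$. *)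

theory Defs
  imports "HOL-Analysis.Analysis" "HOL-Computational_Algebra.Polynomial"
begin

text \<open>
  An \<open>m \<times> n\<close> real matrix has type \<open>real ^ 'n ^ 'm\<close>, with \<open>m = CARD('m)\<close> rows and
  \<open>n = CARD('n)\<close> columns. At this type \<open>norm\<close> is the Frobenius norm, and \<open>*\<close> (as opposed to
  the matrix product \<open>**\<close>) is the entrywise product.
\<close>

definition pattern :: "real ^ 'n ^ 'm \<Rightarrow> real ^ 'n ^ 'm" where
  "pattern A = (\<chi> i j. if A $ i $ j = 0 then 0 else 1)"

definition charpoly :: "real ^ 'm ^ 'm \<Rightarrow> real poly" where
  "charpoly B = det (mat [:0, 1:] - (\<chi> i j. [:B $ i $ j:]))"

text \<open>
  A list with multiplicity is rendered as a multiset. The eigenvalues are the roots of the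
  characteristic polynomial; those of \<open>M M\<^sup>T\<close> are all real, so none is lost by taking real
  roots only, and there are \<open>m\<close> of them for every \<open>n\<close>.
\<close>

definition singular_values :: "real ^ 'n ^ 'm \<Rightarrow> real multiset" where
  "singular_values M = image_mset sqrt (proots (charpoly (M ** transpose M)))"

definition symmetric_matrix :: "real ^ 'm ^ 'm \<Rightarrow> bool" where
  "symmetric_matrix B \<longleftrightarrow> transpose B = B"

definition SSVP :: "real ^ 'n ^ 'm \<Rightarrow> bool" where
  "SSVP A \<longleftrightarrow>
     (\<forall>X :: real ^ 'n ^ 'm.
        symmetric_matrix (X ** transpose A) \<and> symmetric_matrix (transpose A ** X) \<and> A * X = 0
        \<longrightarrow> X = 0)"

end

theory Submission
  imports Defs
begin

text \<open>
  Matrices \<open>M\<close> and \<open>N\<close> have the same singular values as soon as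
  \<open>(I + K) N (I + L) = (I - K) M (I - L)\<close> for some skew-symmetric \<open>K\<close> and \<open>L\<close>, because the
  Cayley transforms of \<open>K\<close> and \<open>L\<close> are orthogonal. Take \<open>N = A + A \<circ> B\<close>, which has the pattern
  of \<open>A\<close> for small \<open>B\<close>. At \<open>K = L = B = 0\<close>, \<open>M = A\<close> the difference of the two sides has the
  partial derivative \<open>2 K A + 2 A L + A \<circ> B\<close> in \<open>(K, L, B)\<close>, and a matrix orthogonal to its range
  is exactly an \<open>X\<close> as in the definition of the SSVP. So the SSVP makes this derivative onto, and
  the equation is solvable for every \<open>M\<close> close to \<open>A\<close> by the open mapping theorem for maps
  differentiable at one point. Finally, the SSVP is an open condition.
\<close>

section \<open>Matrix algebra\<close>

lemma matrix_diff_ldistrib: "(A::real^'n^'m) ** (B - C) = A ** B - A ** C"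
  by (vector matrix_matrix_mult_def sum_subtractf[symmetric] right_diff_distrib)

lemma matrix_diff_rdistrib: "((A::real^'n^'m) - B) ** C = A ** C - B ** C"
  by (vector matrix_matrix_mult_def sum_subtractf[symmetric] left_diff_distrib)

lemma matrix_add_rdistrib: "((A::real^'n^'m) + B) ** C = A ** C + B ** C"
  by (vector matrix_matrix_mult_def sum.distrib[symmetric] distrib_right)

lemma transpose_add: "transpose (A + B :: real^'n^'m) = transpose A + transpose B"
  by (vector transpose_def)

lemma transpose_diff: "transpose (A - B :: real^'n^'m) = transpose A - transpose B"
  by (vector transpose_def)

lemma linear_transpose: "linear (transpose :: real^'n^'m \<Rightarrow> real^'m^'n)"
  by (rule linearI) (simp_all add: transpose_add transpose_scalar)

lemma bounded_bilinear_matrix_matrix_mult: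
  "bounded_bilinear ((**) :: real^'n^'m \<Rightarrow> real^'k^'n \<Rightarrow> real^'k^'m)"
  by (rule bilinear_conv_bounded_bilinear[THEN iffD1])
    (auto simp: bilinear_def matrix_add_ldistrib matrix_add_rdistrib
      scalar_matrix_assoc[symmetric] matrix_scalar_ac intro!: linearI)

lemma bounded_bilinear_times_matrix:
  "bounded_bilinear ((*) :: real^'n^'m \<Rightarrow> real^'n^'m \<Rightarrow> real^'n^'m)"
  by (rule bilinear_conv_bounded_bilinear[THEN iffD1])
    (auto simp: bilinear_def distrib_left distrib_right intro!: linearI)

section \<open>Frobenius duality and surjectivity of the derivative\<close>

lemma inner_transpose: "transpose X \<bullet> transpose Y = X \<bullet> (Y :: real^'n^'m)"
  unfolding inner_vec_def transpose_def by (simp add: sum.swap[of _ "UNIV :: 'n set"])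

lemma inner_matrix_mult_left:
  fixes X :: "real^'k^'m" and Y :: "real^'n^'m" and Z :: "real^'k^'n"
  shows "X \<bullet> (Y ** Z) = (X ** transpose Z) \<bullet> Y"
proof -
  have "X \<bullet> (Y ** Z) = (\<Sum>i\<in>UNIV. \<Sum>j\<in>UNIV. \<Sum>k\<in>UNIV. X$i$j * (Y$i$k * Z$k$j))"
    by (simp add: inner_vec_def matrix_matrix_mult_def sum_distrib_left)
  also have "\<dots> = (\<Sum>i\<in>UNIV. \<Sum>k\<in>UNIV. \<Sum>j\<in>UNIV. X$i$j * (Y$i$k * Z$k$j))"
    by (intro sum.cong refl sum.swap)
  also have "\<dots> = (X ** transpose Z) \<bullet> Y"
    by (simp add: inner_vec_def matrix_matrix_mult_def transpose_def sum_distrib_left sum_distrib_right mult_ac)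
  finally show ?thesis .
qed

lemma inner_matrix_mult_right:
  fixes X :: "real^'k^'m" and Y :: "real^'n^'m" and Z :: "real^'k^'n"
  shows "X \<bullet> (Y ** Z) = (transpose Y ** X) \<bullet> Z"
  using inner_matrix_mult_left[of "transpose X" "transpose Z" "transpose Y"]
    inner_transpose[of X "Y ** Z"] inner_transpose[of "transpose Y ** X" Z]
  by (simp add: matrix_transpose_mul)

lemma inner_times_matrix: "X \<bullet> (A * B) = (A * X) \<bullet> (B :: real^'n^'m)"
  by (simp add: inner_vec_def algebra_simps)

text \<open>Taking the skew part is self-adjoint for the Frobenius product, so the hypothesis says
  that \<open>S - transpose S\<close> is orthogonal to every matrix.\<close>

lemma symmetric_if_orthogonal_to_skew:
  fixes S :: "real^'n^'n"
  assumes "\<And>Z. S \<bullet> (Z - transpose Z) = 0"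
  shows "symmetric_matrix S"
proof -
  have "(S - transpose S) \<bullet> Z = S \<bullet> (Z - transpose Z)" for Z
    using inner_transpose[of S "transpose Z"] by (simp add: inner_diff_left inner_diff_right)
  then have "S - transpose S = 0"
    using assms by (metis inner_eq_zero_iff)
  then show ?thesis by (simp add: symmetric_matrix_def)
qed

text \<open>Writing skew matrices as \<open>Z - transpose Z\<close> makes the domain a full vector
  space. A proper range would lie in a hyperplane with normal \<open>X \<noteq> 0\<close>; testing
  the three arguments one at a time gives the three SSVP conditions on \<open>X\<close>.\<close>

lemma SSVP_imp_surj:
  fixes A :: "real^'n^'m"
  assumes "SSVP A"
  shows "surj (\<lambda>(Z, W, B). 2 *\<^sub>R ((Z - transpose Z) ** A) + 2 *\<^sub>R (A ** (W - transpose W)) + A * B)"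
    (is "surj ?D")
proof (rule ccontr)
  assume nsurj: "\<not> surj ?D"
  interpret t: linear "transpose :: real^'m^'m \<Rightarrow> _" by (rule linear_transpose)
  interpret s: linear "transpose :: real^'n^'n \<Rightarrow> _" by (rule linear_transpose)
  have "linear ?D"
    by (rule linearI)
      (auto simp: t.add s.add t.scale s.scale matrix_add_ldistrib matrix_add_rdistrib
        matrix_diff_ldistrib matrix_diff_rdistrib distrib_left
        scalar_matrix_assoc[symmetric] matrix_scalar_ac algebra_simps)
  then have "subspace (range ?D)"
    by (rule linear_subspace_image) (rule subspace_UNIV)
  with nsurj have "span (range ?D) \<noteq> UNIV"
    by (simp only: span_eq_iff[THEN iffD2] not_False_eq_True)
  from span_not_univ_subset_hyperplane[OF this]
  obtain X where X: "X \<noteq> 0" "span (range ?D) \<subseteq> {Y. X \<bullet> Y = 0}" by blast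
  have orth: "X \<bullet> ?D (Z, W, B) = 0" for Z W B
    using subsetD[OF X(2) span_base[OF rangeI[of ?D "(Z, W, B)"]]] by simp
  have "X \<bullet> ((Z - transpose Z) ** A) = 0" for Z
    using orth[of Z 0 0] by (simp add: s.zero matrix_diff_ldistrib)
  then have 1: "symmetric_matrix (X ** transpose A)"
    by (intro symmetric_if_orthogonal_to_skew) (metis inner_matrix_mult_left)
  have "X \<bullet> (A ** (W - transpose W)) = 0" for W
    using orth[of 0 W 0] by (simp add: t.zero matrix_diff_rdistrib)
  then have 2: "symmetric_matrix (transpose A ** X)"
    by (intro symmetric_if_orthogonal_to_skew) (metis inner_matrix_mult_right)
  have "(A * X) \<bullet> B = 0" for B
    using orth[of 0 0 B] by (simp add: s.zero t.zero inner_times_matrix matrix_diff_rdistrib matrix_diff_ldistrib)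
  then have "A * X = 0" by (metis inner_eq_zero_iff)
  with 1 2 assms X(1) show False by (auto simp: SSVP_def)
qed

section \<open>Openness of the SSVP\<close>

lemma SSVP_perturbation:
  fixes A :: "real^'n^'m"
  assumes "SSVP A"
  obtains \<delta> where "\<delta> > 0" "\<And>N. norm (N - A) < \<delta> \<Longrightarrow> SSVP N"
proof -
  \<comment> \<open>The SSVP of \<open>N\<close> is injectivity of \<open>T N\<close>. An injective
    linear map in finite dimension is bounded below, and this survives a small change of
    \<open>N\<close>.\<close>
  define T where "T = (\<lambda>(N :: real^'n^'m) (X :: real^'n^'m).
    (X ** transpose N - N ** transpose X, transpose N ** X - transpose X ** N, N * X))"
  have "bilinear T"
    unfolding bilinear_def T_def
    by (auto intro!: linearI simp: transpose_add transpose_scalar matrix_add_ldistrib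
      matrix_add_rdistrib distrib_left distrib_right scaleR_diff_right
      scalar_matrix_assoc[symmetric] matrix_scalar_ac)
  then interpret T: bounded_bilinear T by (simp add: bilinear_conv_bounded_bilinear)
  have lin: "linear (T N)" for N
    using \<open>bilinear T\<close> by (simp add: bilinear_def)
  have T_eq_0: "T N X = 0 \<longleftrightarrow>
    symmetric_matrix (X ** transpose N) \<and> symmetric_matrix (transpose N ** X) \<and> N * X = 0" for N X
    by (auto simp: T_def symmetric_matrix_def zero_prod_def matrix_transpose_mul)
  have "inj (T A)"
    using assms T_eq_0 by (metis SSVP_def lin linear_injective_0)
  then obtain c where c: "c > 0" "\<And>X. c * norm X \<le> norm (T A X)"
    using linear_inj_bounded_below_pos[OF lin] by metis
  obtain K where K: "K > 0" "\<And>N X. norm (T N X) \<le> norm N * norm X * K"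
    using T.pos_bounded by blast
  have "SSVP N" if N: "norm (N - A) < c / K" for N
  proof -
    have "X = 0" if "T N X = 0" for X
    proof (rule ccontr)
      assume "X \<noteq> 0"
      \<comment> \<open>As \<open>T N X = 0\<close>, the vectors \<open>T (N - A) X\<close> and
        \<open>T A X\<close> differ only in sign.\<close>
      have "c * norm X \<le> norm (T (N - A) X)"
        using c(2)[of X] that by (simp add: T.diff_left)
      also have "\<dots> \<le> (norm (N - A) * K) * norm X"
        using K(2)[of "N - A" X] by (simp add: mult_ac)
      also have "\<dots> < c * norm X"
        using N K(1) \<open>X \<noteq> 0\<close> by (simp add: field_simps)
      finally show False by simp
    qed
    then show ?thesis
      unfolding SSVP_def T_eq_0[symmetric] by blast
  qed
  moreover have "c / K > 0" using c K by simp
  ultimately show thesis using that by blast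
qed

section \<open>Orthogonal invariance of the singular values\<close>

lemma charpoly_orthogonal_conjugate:
  fixes U C :: "real^'m^'m"
  assumes "orthogonal_matrix U"
  shows "charpoly (U ** C ** transpose U) = charpoly C"
proof -
  \<comment> \<open>Lifting to constant polynomials lets the similarity act on the characteristic
    matrix itself; its scalar part is central and its determinant is multiplicative.\<close>
  define cst :: "real^'m^'m \<Rightarrow> real poly^'m^'m" where "cst B = (\<chi> i j. [:B $ i $ j:])" for B
  have cst_mult: "cst (B ** C) = cst B ** cst C" for B C
    by (simp add: cst_def matrix_matrix_mult_def vec_eq_iff poly_eq_iff coeff_sum coeff_pCons
        mult.commute split: nat.split)
  have cst_1: "cst (mat 1) = mat 1"
    by (simp add: cst_def mat_def vec_eq_iff)
  have sim: "mat x ** (B :: real poly^'m^'m) = B ** mat x" for x B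
    by (simp add: matrix_matrix_mult_def mat_def vec_eq_iff if_distrib if_distribR
        sum.delta sum.delta' mult.commute cong: if_cong)
  have diff: "P ** (Q - R) ** S = P ** Q ** S - P ** R ** S" for P Q R S :: "real poly^'m^'m"
    by (simp add: matrix_matrix_mult_def vec_eq_iff right_diff_distrib left_diff_distrib sum_subtractf)
  have UU: "cst U ** cst (transpose U) = mat 1"
    using assms by (simp add: cst_mult[symmetric] cst_1 orthogonal_matrix_def)
  have "mat [:0, 1:] - cst (U ** C ** transpose U)
      = cst U ** (mat [:0, 1:] - cst C) ** cst (transpose U)"
  proof -
    have "cst U ** mat [:0, 1:] ** cst (transpose U) = mat [:0, 1:]"
      by (simp only: sim[symmetric]) (simp only: matrix_mul_assoc[symmetric] UU matrix_mul_rid)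
    then show ?thesis by (simp only: diff cst_mult)
  qed
  then have "charpoly (U ** C ** transpose U)
      = (det (cst U) * det (cst (transpose U))) * charpoly C"
    unfolding charpoly_def cst_def[symmetric] by (simp add: det_mul mult_ac)
  also have "det (cst U) * det (cst (transpose U)) = 1"
    by (simp add: det_mul[symmetric] UU)
  finally show ?thesis by simp
qed

lemma singular_values_orthogonal:
  fixes N :: "real^'n^'m"
  assumes "orthogonal_matrix U" "orthogonal_matrix V"
  shows "singular_values (U ** N ** V) = singular_values N"
proof -
  have "(U ** N ** V) ** transpose (U ** N ** V)
      = U ** N ** (V ** transpose V) ** transpose N ** transpose U"
    by (simp add: matrix_transpose_mul matrix_mul_assoc)
  also have "\<dots> = U ** (N ** transpose N) ** transpose U"
    using assms(2) by (simp add: orthogonal_matrix_def matrix_mul_assoc)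
  finally show ?thesis
    by (simp add: singular_values_def charpoly_orthogonal_conjugate[OF assms(1)])
qed

section \<open>Cayley transforms\<close>

lemma invertible_1_minus_skew:
  fixes K :: "real^'n^'n"
  assumes "transpose K = - K"
  shows "invertible (mat 1 - K)"
proof -
  have "x = 0" if "(mat 1 - K) *v x = 0" for x
  proof -
    have "K *v x = x" using that by (simp add: matrix_vector_mult_diff_rdistrib)
    \<comment> \<open>Skewness gives \<open>x \<bullet> (K *v x) = 0\<close>, while
      \<open>K *v x = x\<close> makes this \<open>x \<bullet> x\<close>.\<close>
    moreover have "x v* K = - (K *v x)"
      unfolding transpose_matrix_vector[symmetric] assms
      by (simp add: matrix_vector_mult_def vec_eq_iff sum_negf)
    then have "x \<bullet> (K *v x) = - (x \<bullet> (K *v x))"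
      using dot_lmul_matrix[of x K x] by (simp add: inner_commute)
    ultimately show "x = 0" by simp
  qed
  then show ?thesis
    using matrix_left_invertible_ker invertible_left_inverse by blast
qed

text \<open>The orthogonal factor is the Cayley transform \<open>(I - K)\<^sup>-\<^sup>1 (I + K)\<close>.\<close>

lemma cayley:
  fixes K :: "real^'n^'n"
  assumes "transpose K = - K"
  obtains U where "orthogonal_matrix U" "mat 1 + K = (mat 1 - K) ** U"
proof -
  obtain R where R: "R ** (mat 1 - K) = mat 1" "(mat 1 - K) ** R = mat 1"
    using invertible_1_minus_skew[OF assms] unfolding invertible_def by blast
  have tr: "transpose (mat 1 - K) = mat 1 + K" "transpose (mat 1 + K) = mat 1 - K"
    by (simp_all add: transpose_diff transpose_add assms)
  have comm: "(mat 1 + K) ** (mat 1 - K) = (mat 1 - K) ** (mat 1 + K)"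
    by (simp add: matrix_diff_ldistrib matrix_diff_rdistrib matrix_add_ldistrib matrix_add_rdistrib)
  have "(R ** (mat 1 + K)) ** transpose (R ** (mat 1 + K))
      = R ** ((mat 1 + K) ** (mat 1 - K)) ** transpose R"
    by (simp add: matrix_transpose_mul tr matrix_mul_assoc)
  also have "\<dots> = (R ** (mat 1 - K)) ** transpose (R ** (mat 1 - K))"
    by (simp only: comm matrix_transpose_mul tr matrix_mul_assoc)
  also have "\<dots> = mat 1" by (simp add: R)
  finally have "orthogonal_matrix (R ** (mat 1 + K))"
    by (simp add: orthogonal_matrix_def matrix_left_right_inverse)
  moreover have "mat 1 + K = (mat 1 - K) ** (R ** (mat 1 + K))"
    by (simp add: matrix_mul_assoc R)
  ultimately show thesis using that by blast
qed

lemma singular_values_eq_if_cayley_equation: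
  fixes M N :: "real^'n^'m"
  assumes K: "transpose K = - K" and L: "transpose L = - L"
    and eq: "(mat 1 + K) ** N ** (mat 1 + L) = (mat 1 - K) ** M ** (mat 1 - L)"
  shows "singular_values N = singular_values M"
proof -
  obtain U where U: "orthogonal_matrix U" "mat 1 + K = (mat 1 - K) ** U"
    using cayley[OF K] .
  obtain V where V: "orthogonal_matrix V" "mat 1 + L = (mat 1 - L) ** V"
    using cayley[OF L] .
  \<comment> \<open>\<open>V\<close> must stand next to \<open>N\<close>, so it has to move to the
    left of \<open>mat 1 - L\<close>. Transposition swaps \<open>mat 1 + L\<close> and
    \<open>mat 1 - L\<close> and reverses the product.\<close>
  have "transpose (mat 1 + L) = transpose V ** transpose (mat 1 - L)"
    unfolding V(2) by (rule matrix_transpose_mul)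
  then have "mat 1 - L = transpose V ** (mat 1 + L)"
    by (simp add: transpose_add transpose_diff L)
  then have V': "mat 1 + L = V ** (mat 1 - L)"
    using V(1) by (metis matrix_mul_assoc matrix_mul_lid orthogonal_matrix_def)
  obtain R where R: "R ** (mat 1 - K) = mat 1"
    using invertible_1_minus_skew[OF K] invertible_left_inverse by blast
  obtain S where S: "(mat 1 - L) ** S = mat 1"
    using invertible_1_minus_skew[OF L] invertible_right_inverse by blast
  have "R ** ((mat 1 - K) ** (U ** N ** V) ** (mat 1 - L)) ** S
      = R ** ((mat 1 - K) ** M ** (mat 1 - L)) ** S"
    using eq unfolding U(2) V' by (simp add: matrix_mul_assoc)
  moreover have "R ** ((mat 1 - K) ** Y ** (mat 1 - L)) ** S = Y" for Y
    by (metis R S matrix_mul_assoc matrix_mul_lid matrix_mul_rid)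
  ultimately have "U ** N ** V = M" by simp
  then show ?thesis using singular_values_orthogonal[OF U(1) V(1), of N] by simp
qed

section \<open>Solving the equation near \<open>A\<close>\<close>

lemma pattern_perturbation:
  fixes A B :: "real^'n^'m"
  assumes "norm B < 1"
  shows "pattern (A + A * B) = pattern A"
proof -
  \<comment> \<open>Each entry of \<open>B\<close> is bounded in absolute value by
    \<open>norm B < 1\<close>.\<close>
  have "1 + B $ i $ j \<noteq> 0" for i j
    using assms Finite_Cartesian_Product.norm_nth_le[of "B $ i" j] Finite_Cartesian_Product.norm_nth_le[of B i] by auto
  moreover have "A $ i $ j + A $ i $ j * B $ i $ j = A $ i $ j * (1 + B $ i $ j)" for i j
    by (simp add: algebra_simps)
  ultimately show ?thesis by (simp add: pattern_def vec_eq_iff)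
qed

theorem theorem4p3:
  fixes A P :: "real ^ 'n ^ 'm"
  assumes "pattern A = P"
    and "SSVP A"
  shows "\<exists>\<epsilon>>0. \<forall>M :: real ^ 'n ^ 'm. norm (M - A) < \<epsilon> \<longrightarrow>
           (\<exists>B :: real ^ 'n ^ 'm. SSVP B \<and> pattern B = P \<and> singular_values B = singular_values M)"
proof -
  define sk where "sk Z = Z - transpose Z" for Z :: "real^'m^'m"
  define sl where "sl Z = Z - transpose Z" for Z :: "real^'n^'n"
  define D where "D = (\<lambda>(Z, W, B). 2 *\<^sub>R (sk Z ** A) + 2 *\<^sub>R (A ** sl W) + A * B)"
  \<comment> \<open>\<open>M\<close> is kept as a variable and first output: the equation stays polynomial, and hitting
    \<open>(M, 0)\<close> solves it for the given \<open>M\<close>.\<close>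
  define f where "f = (\<lambda>(Z, W, B, M).
    (M, (mat 1 + sk Z) ** (A + A * B) ** (mat 1 + sl W) - (mat 1 - sk Z) ** M ** (mat 1 - sl W)))"
  define f' where "f' = (\<lambda>(Z, W, B, M). (M, D (Z, W, B) - M))"
  obtain \<delta> where \<delta>: "\<delta> > 0" "\<And>N. norm (N - A) < \<delta> \<Longrightarrow> SSVP N"
    using SSVP_perturbation[OF assms(2)] by metis
  have bl_sk: "bounded_linear sk" and bl_sl: "bounded_linear sl"
    unfolding sk_def sl_def
    by (intro bounded_linear_sub bounded_linear_ident linear_transpose[unfolded linear_conv_bounded_linear])+
  note [continuous_intros] = bounded_linear.continuous_on[OF bl_sk] bounded_linear.continuous_on[OF bl_sl]
    bounded_bilinear.continuous_on[OF bounded_bilinear_matrix_matrix_mult]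
    bounded_bilinear.continuous_on[OF bounded_bilinear_times_matrix]
  have sk0: "sk 0 = 0" and sl0: "sl 0 = 0"
    using bl_sk bl_sl by (simp_all add: linear_simps)
  have cont: "continuous_on UNIV f"
    unfolding f_def case_prod_unfold by (intro continuous_intros)
  have deriv: "(f has_derivative f') (at (0, 0, 0, A))"
  proof -
    let ?F = "at (0, 0, 0, A) :: ((real^'m^'m) \<times> (real^'n^'n) \<times> (real^'n^'m) \<times> (real^'n^'m)) filter"
    have K: "((\<lambda>x. sk (fst x)) has_derivative (\<lambda>x. sk (fst x))) ?F"
      and L: "((\<lambda>x. sl (fst (snd x))) has_derivative (\<lambda>x. sl (fst (snd x)))) ?F"
      and B: "((\<lambda>x. fst (snd (snd x))) has_derivative (\<lambda>x. fst (snd (snd x)))) ?F"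
      and M: "((\<lambda>x. snd (snd (snd x))) has_derivative (\<lambda>x. snd (snd (snd x)))) ?F"
      by (intro bounded_linear_imp_has_derivative bounded_linear_compose[OF bl_sk]
          bounded_linear_compose[OF bl_sl] bounded_linear_fst_comp bounded_linear_snd_comp
          bounded_linear_ident)+
    \<comment> \<open>At the base point \<open>sk\<close> and \<open>sl\<close> vanish. The skew
      terms of the two sides have opposite signs, so their difference doubles them: hence the
      factors 2 in \<open>D\<close>.\<close>
    show ?thesis
      unfolding f_def case_prod_unfold
      by (rule has_derivative_eq_rhs, (rule K L B M has_derivative_const has_derivative_Pair
          has_derivative_diff has_derivative_add
          bounded_bilinear.FDERIV[OF bounded_bilinear_matrix_matrix_mult]
          bounded_bilinear.FDERIV[OF bounded_bilinear_times_matrix])+)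
        (simp add: fun_eq_iff f'_def D_def sk0 sl0 matrix_add_ldistrib matrix_add_rdistrib
          matrix_diff_ldistrib matrix_diff_rdistrib scaleR_2
          bounded_bilinear.minus_left[OF bounded_bilinear_matrix_matrix_mult]
          bounded_bilinear.minus_right[OF bounded_bilinear_matrix_matrix_mult])
  qed
  have "surj D"
    using SSVP_imp_surj[OF assms(2)] by (simp add: D_def sk_def sl_def)
  have "surj f'"
  \<comment> \<open>To hit \<open>(m, y)\<close>, the last argument must be \<open>m\<close>, and
    then \<open>D\<close> has to take the value \<open>y + m\<close>.\<close>
  proof (rule surjI[of _ "\<lambda>(m, y). (\<lambda>(z, w, b). (z, w, b, m)) (inv D (y + m))"])
    fix x :: "(real^'n^'m) \<times> (real^'n^'m)"
    obtain m y where "x = (m, y)" by fastforce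
    then show "f' (case x of (m, y) \<Rightarrow> (\<lambda>(z, w, b). (z, w, b, m)) (inv D (y + m))) = x"
      using surj_f_inv_f[OF \<open>surj D\<close>, of "y + m"] by (simp add: f'_def case_prod_unfold)
  qed
  moreover have "linear f'"
    using deriv has_derivative_linear by blast
  ultimately obtain g where g: "linear g" "f' \<circ> g = id"
    using linear_surjective_right_inverse by blast
  \<comment> \<open>The first bound preserves the pattern; the second keeps \<open>A + A * B\<close>
    within \<open>\<delta>\<close> of \<open>A\<close>, where the SSVP holds.\<close>
  define T :: "((real^'m^'m) \<times> (real^'n^'n) \<times> (real^'n^'m) \<times> (real^'n^'m)) set"
    where "T = {x. norm (fst (snd (snd x))) < 1 \<and> norm (A * fst (snd (snd x))) < \<delta>}"
  have "open T"
    unfolding T_def Collect_conj_eq by (intro open_Int open_Collect_less continuous_intros)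
  moreover have "(0, 0, 0, A) \<in> T" using \<delta>(1) by (simp add: T_def)
  ultimately have "(0, 0, 0, A) \<in> interior T" by (simp add: interior_open)
  \<comment> \<open>The right inverse \<open>g\<close> of the derivative makes \<open>f\<close> open
    at the base point, so all targets near \<open>(A, 0)\<close> are reached from within
    \<open>T\<close>.\<close>
  then have "f (0, 0, 0, A) \<in> interior (f ` T)"
    using sussmann_open_mapping[OF open_UNIV cont UNIV_I deriv _ g(2) subset_UNIV] g(1)
    by (simp add: linear_conv_bounded_linear)
  moreover have "f (0, 0, 0, A) = (A, 0)" by (simp add: f_def sk0 sl0)
  ultimately obtain \<epsilon> where \<epsilon>: "\<epsilon> > 0" "ball (A, 0) \<epsilon> \<subseteq> f ` T"
    by (metis mem_interior)
  show ?thesis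
  proof (intro exI[of _ \<epsilon>] conjI allI impI)
    show "\<epsilon> > 0" by fact
    fix M :: "real^'n^'m"
    assume "norm (M - A) < \<epsilon>"
    then have "(M, 0) \<in> ball (A, 0) \<epsilon>"
      by (simp add: dist_Pair_Pair dist_norm norm_minus_commute)
    then obtain Z W B M' where T: "(Z, W, B, M') \<in> T" and f: "f (Z, W, B, M') = (M, 0)"
      using \<epsilon>(2) by (metis (no_types, lifting) imageE prod_cases4 subsetD)
    let ?N = "A + A * B"
    \<comment> \<open>The first output of \<open>f\<close> forces \<open>M' = M\<close>; the zero
      second output is the Cayley equation.\<close>
    have "(mat 1 + sk Z) ** ?N ** (mat 1 + sl W) = (mat 1 - sk Z) ** M ** (mat 1 - sl W)"
      using f by (simp add: f_def)
    then have "singular_values ?N = singular_values M"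
      by (rule singular_values_eq_if_cayley_equation[rotated 2])
        (simp_all add: sk_def sl_def transpose_diff)
    moreover have "SSVP ?N" using \<delta>(2)[of ?N] T by (simp add: T_def)
    moreover have "pattern ?N = P"
      using pattern_perturbation[of B A] T assms(1) by (simp add: T_def)
    ultimately show "\<exists>B. SSVP B \<and> pattern B = P \<and> singular_values B = singular_values M"
      by blast
  qed
qed

end
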